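(* If $\Gamma$ is a distance-regular graph with classical parameters $(D,b,\alpha,\beta)$ such that $b=2$ and $D\geq 12$, then $\alpha\leq 2$ and $\alpha\in\{0,\frac{1}{3},\frac{2}{3},1,\frac{4}{3},2\}$.
   Context: All graphs are finite, undirected and simple. A connected graph $\Gamma$ of diameter $D$ is distance-regular if for each $0\le i\le D$ there are integers $b_i,c_i$ such that for any two vertices $x,y$ at distance $i$, exactly $c_i$ neighbours of $y$ are at distance $i-1$ from $x$ and exactly $b_i$ neighbours of $y$ are at distance $i+1$ from $x$. Write $\left[\begin{smallmatrix} i\\ 1\end{smallmatrix}\right]_b=1+b+\dots+b^{i-1}$. A distance-regular graph of diameter $D$ has classical parameters $(D,b,\alpha,\beta)$ if for all $0\le i\le D$: $c_i=\left[\begin{smallmatrix} i\\ 1\end{smallmatrix}\right]_b\bigl(1+\alpha\left[\begin{smallmatrix} i-1\\ 1\end{smallmatrix}\right]_b\bigr)$ and $b_i=\bigl(\left[\begin{smallmatrix} D\\ 1\end{smallmatrix}\right]_b-\left[\begin{smallmatrix} i\\ 1\end{smallmatrix}\right]_b\bigr)\bigl(\beta-\alpha\left[\begin{smallmatrix} i\\ 1\end{smallmatrix}\right]_b\bigr)$. *)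

theory Defs
  imports Complex_Main "Graph_Theory.Graph_Theory"
begin

text \<open>
  Finite undirected simple graphs are the symmetric, loop-free digraphs without multiple arcs of
  the locale \<^locale>\<open>graph\<close>; each edge is represented by a pair of opposite arcs.
\<close>

definition graph_dist :: "('a, 'b) pre_digraph \<Rightarrow> 'a \<Rightarrow> 'a \<Rightarrow> nat" where
  "graph_dist G x y = (LEAST n. \<exists>p. pre_digraph.awalk G x p y \<and> length p = n)"

text \<open>
  On vertices joined by a walk this is the library's shortest-path distance for unit weights.
  Elsewhere \<^const>\<open>graph_dist\<close> is unspecified; it is only used for connected graphs.
\<close>

lemma (in wf_digraph) graph_dist_eq_unit_weight:
  assumes "x \<rightarrow>\<^sup>* y"
  shows "\<mu> (\<lambda>_. 1) x y = ereal (real (graph_dist G x y))"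
proof -
  have cost: "awalk_cost (\<lambda>_. 1) p = real (length p)" for p
    by (induction p) auto
  from assms obtain q where q: "awalk x q y"
    by (auto simp: reachable_awalk)
  have "\<exists>p. awalk x p y \<and> length p = graph_dist G x y"
    unfolding graph_dist_def by (rule LeastI_ex) (use q in blast)
  then obtain p where p: "awalk x p y" "length p = graph_dist G x y" by blast
  have "graph_dist G x y \<le> length r" if "awalk x r y" for r
    unfolding graph_dist_def by (rule Least_le) (use that in blast)
  then show ?thesis
    unfolding \<mu>_def cost using p
    by (intro antisym INF_greatest INF_lower2[of p]) auto
qed

definition graph_diameter :: "('a, 'b) pre_digraph \<Rightarrow> nat" where
  "graph_diameter G = Max {graph_dist G x y | x y. x \<in> verts G \<and> y \<in> verts G}"

text \<open>
  Distance \<open>i - 1\<close> is expressed by \<open>graph_dist G x z + 1 = i\<close> rather than with truncated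
  subtraction, so that no vertex qualifies for \<open>i = 0\<close>.
\<close>

definition intersection_numbers ::
  "('a, 'b) pre_digraph \<Rightarrow> (nat \<Rightarrow> int) \<Rightarrow> (nat \<Rightarrow> int) \<Rightarrow> bool" where
  "intersection_numbers G bs cs \<longleftrightarrow>
    (\<forall>i \<le> graph_diameter G. \<forall>x \<in> verts G. \<forall>y \<in> verts G. graph_dist G x y = i \<longrightarrow>
      int (card {z \<in> verts G. y \<rightarrow>\<^bsub>G\<^esub> z \<and> graph_dist G x z + 1 = i}) = cs i \<and>
      int (card {z \<in> verts G. y \<rightarrow>\<^bsub>G\<^esub> z \<and> graph_dist G x z = i + 1}) = bs i)"

definition distance_regular :: "('a, 'b) pre_digraph \<Rightarrow> bool" where
  "distance_regular G \<longleftrightarrow> graph G \<and> connected G \<and> (\<exists>bs cs. intersection_numbers G bs cs)"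

definition q_bracket :: "real \<Rightarrow> nat \<Rightarrow> real" where
  "q_bracket b i = (\<Sum>k<i. b ^ k)"

text \<open>
  In a connected graph every distance \<open>i \<le> D\<close> is realised, so the intersection numbers are
  uniquely determined for these \<open>i\<close> and the existential quantifier involves no choice.
  For \<open>i = 0\<close> the truncated \<open>i - 1\<close> is harmless, as the factor \<open>q_bracket b 0\<close> vanishes.
\<close>

definition has_classical_parameters ::
  "('a, 'b) pre_digraph \<Rightarrow> nat \<Rightarrow> real \<Rightarrow> real \<Rightarrow> real \<Rightarrow> bool" where
  "has_classical_parameters G D b \<alpha> \<beta> \<longleftrightarrow>
    distance_regular G \<and> graph_diameter G = D \<and>
    (\<exists>bs cs. intersection_numbers G bs cs \<and>
      (\<forall>i \<le> D.
        real_of_int (cs i) = q_bracket b i * (1 + \<alpha> * q_bracket b (i - 1)) \<and>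
        real_of_int (bs i) = (q_bracket b D - q_bracket b i) * (\<beta> - \<alpha> * q_bracket b i)))"

end

theory Submission
  imports Defs "HOL-Computational_Algebra.Primes" "Jordan_Normal_Form.Schur_Decomposition"
begin

text \<open>
  Everything rests on integrality. Put \<open>t = 3 * \<alpha> = c 2 - 3\<close>, a natural number. Two vertices at
  distance \<open>i + j\<close> have exactly \<open>c 1 \<cdots> c (i + j) / (c 1 \<cdots> c i * c 1 \<cdots> c j)\<close> vertices between
  them at distance \<open>i\<close> from the first one, and this number depends on \<open>\<alpha>\<close> only. It being an integer
  for \<open>i = j = 2\<close> means that \<open>t + 3\<close> divides 1260; the case \<open>i = j = 6\<close> then leaves
  \<open>t \<in> {0, 1, 2, 3, 4, 6, 27}\<close>, and \<open>i = j = 7\<close> excludes \<open>t = 27\<close> when \<open>D \<ge> 14\<close>.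

  For \<open>\<alpha> = 9\<close> and \<open>D \<in> {12, 13}\<close> the multiplicity of the second largest eigenvalue,
  \<open>(2 ^ D - 1) * \<beta> * (2 ^ D * (\<beta> + 9) / 2 - 16) / ((9 * 2 ^ D / 2 - 8) * (\<beta> - 7))\<close>, must be an integer.
  With \<open>\<beta> > 9 * (2 ^ (D - 1) - 1)\<close> this is impossible for \<open>D = 13\<close> and forces \<open>\<beta> = 128968\<close> for
  \<open>D = 12\<close>, where the number of vertices at distance 7 from a vertex would not be an integer.
\<close>

section \<open>Divisibility\<close>

text \<open>
  If \<open>M\<close> has a prime factor \<open>p\<close>, the conclusion is a quadratic congruence for \<open>e\<close> modulo \<open>p\<close>. It
  reduces the search for divisors \<open>d\<close> of \<open>c * s * t\<close> with a bounded cofactor \<open>e\<close> to few residue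
  classes.
\<close>

lemma cofactor_quadratic:
  fixes M m d e a c s t :: int
  assumes "M * m * d = c * ((d + s) * (a * d + t))" "d * e = c * s * t" "d \<noteq> 0"
  shows "M * m * e = e * e + c * (t + s * a) * e + c * a * (c * s * t)"
proof -
  have "d * (M * m) = d * (c * a * d + c * (t + s * a) + e)"
    using assms(1,2) by (simp add: algebra_simps)
  then have "M * m = c * a * d + c * (t + s * a) + e"
    using assms(3) by simp
  then have "M * m * e = c * a * (d * e) + c * (t + s * a) * e + e * e"
    by (simp add: algebra_simps)
  then show ?thesis using assms(2) by simp
qed

text \<open>Here \<open>d\<close> is \<open>\<beta> - 7\<close>, and \<open>eq\<close> is the
  integrality of the multiplicity \<open>m\<close> for \<open>D = 12\<close>, divided by 8. Modulo
  \<open>d\<close> the right side is the constant \<open>8190 * 7 * 2047\<close>, so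
  \<open>d\<close> divides that constant; the lower bound on \<open>d\<close> leaves a small
  cofactor \<open>e\<close> to search.\<close>

lemma multiplicity_12:
  fixes m d :: int
  assumes eq: "2303 * m * d = 8190 * ((d + 7) * (128 * d + 2047))" and d: "18416 < d"
  shows "d = 128961"
proof -
  have "2303 * m * d = d * (8190 * (128 * d + 2943)) + 117354510"
    unfolding eq by (simp add: algebra_simps)
  then have "d dvd 117354510"
    by (metis dvd_add_right_iff dvd_triv_left dvd_triv_right)
  then obtain e where e: "117354510 = d * e" by (rule dvdE)
  have "0 < d * e" unfolding e[symmetric] by simp
  then have "0 < e" using d by (intro zero_less_mult_pos[of d e]) auto
  \<comment> \<open>With \<open>d \<ge> 18417\<close> any larger cofactor would make
    \<open>d * e\<close> exceed the constant.\<close>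
  have "e \<le> 6372"
  proof (rule ccontr)
    assume "\<not> e \<le> 6372"
    then have "18417 * 6373 \<le> d * e" using d by (intro mult_mono) auto
    with e show False by simp
  qed
  have e_dvd: "117354510 mod e = 0" unfolding e by simp
  have "2303 * m * e = e * e + 8190 * (2047 + 7 * 128) * e + 8190 * 128 * (8190 * 7 * 2047)"
    by (rule cofactor_quadratic[OF eq]) (use e d in auto)
  \<comment> \<open>As \<open>2303 = 47 * 49\<close>, the quadratic for \<open>e\<close> can be read
    modulo 47, where it splits with the roots 11 and 17.\<close>
  then have "(e - 11) * (e - 17) = 47 * (49 * m * e - 512834 * e - 2617554891979)"
    by (simp add: algebra_simps)
  then have "47 dvd (e - 11) * (e - 17)"
    by (rule dvdI)
  moreover have "prime (47 :: int)" by simp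
  ultimately have "47 dvd e - 11 \<or> 47 dvd e - 17"
    by (simp only: prime_dvd_mult_iff)
  \<comment> \<open>Dividing the constant is only a necessary condition. The two residue classes
    yield five values of \<open>d\<close>; testing \<open>eq\<close> modulo \<open>2303 * d\<close>
    removes all but 128961.\<close>
  moreover have mod_0: "(8190 * ((d + 7) * (128 * d + 2047))) mod (2303 * d) = 0"
    unfolding eq[symmetric] by (simp add: mod_eq_0_iff_dvd)
  ultimately show ?thesis
  proof (elim disjE)
    assume "47 dvd e - 11"
    then obtain x where "e - 11 = 47 * x" by (rule dvdE)
    then have ex: "e = 47 * x + 11" by simp
    then have x: "x \<in> {0..135}" using \<open>0 < e\<close> \<open>e \<le> 6372\<close> by simp
    have quotients: "\<forall>x\<in>{0..135::int}. 117354510 mod (47 * x + 11) = 0 \<longrightarrow> x \<in> {2, 49}"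
      by (simp add: simp_from_to)
    have "117354510 mod (47 * x + 11) = 0" using e_dvd by (simp only: ex)
    from mp[OF bspec[OF quotients x] this] have "x \<in> {2, 49}" .
    then have "d \<in> {1117662, 50715, 392490, 219765, 128961}"
      using e ex by auto
    then show ?thesis using mod_0 by auto
  next
    assume "47 dvd e - 17"
    then obtain x where "e - 17 = 47 * x" by (rule dvdE)
    then have ex: "e = 47 * x + 17" by simp
    then have x: "x \<in> {0..135}" using \<open>0 < e\<close> \<open>e \<le> 6372\<close> by simp
    have quotients: "\<forall>x\<in>{0..135::int}. 117354510 mod (47 * x + 17) = 0 \<longrightarrow> x \<in> {6, 11, 19}"
      by (simp add: simp_from_to)
    have "117354510 mod (47 * x + 17) = 0" using e_dvd by (simp only: ex)
    from mp[OF bspec[OF quotients x] this] have "x \<in> {6, 11, 19}" .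
    then have "d \<in> {1117662, 50715, 392490, 219765, 128961}"
      using e ex by auto
    then show ?thesis using mod_0 by auto
  qed
qed

text \<open>The same search for \<open>D = 13\<close>: now \<open>4607 = 17 * 271\<close>, the
  quadratic splits modulo 271, and no cofactor in range from either residue class divides the
  constant \<open>16382 * 7 * 4095\<close>.\<close>

lemma multiplicity_13:
  fixes m d :: int
  assumes eq: "4607 * m * d = 16382 * ((d + 7) * (256 * d + 4095))" and d: "36848 < d"
  shows "False"
proof -
  have "4607 * m * d = d * (16382 * (256 * d + 5887)) + 469590030"
    unfolding eq by (simp add: algebra_simps)
  then have "d dvd 469590030"
    by (metis dvd_add_right_iff dvd_triv_left dvd_triv_right)
  then obtain e where e: "469590030 = d * e" by (rule dvdE)
  have "0 < d * e" unfolding e[symmetric] by simp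
  then have "0 < e" using d by (intro zero_less_mult_pos[of d e]) auto
  have "e \<le> 12743"
  proof (rule ccontr)
    assume "\<not> e \<le> 12743"
    then have "36849 * 12744 \<le> d * e" using d by (intro mult_mono) auto
    with e show False by simp
  qed
  have e_dvd: "469590030 mod e = 0" unfolding e by simp
  have "4607 * m * e = e * e + 16382 * (4095 + 7 * 256) * e + 16382 * 256 * (16382 * 7 * 4095)"
    by (rule cofactor_quadratic[OF eq]) (use e d in auto)
  then have "(e - 73) * (e - 134) = 271 * (17 * m * e - 355871 * e - 7267021812118)"
    by (simp add: algebra_simps)
  then have "271 dvd (e - 73) * (e - 134)"
    by (rule dvdI)
  moreover have "prime (271 :: int)" by simp
  ultimately have "271 dvd e - 73 \<or> 271 dvd e - 134"
    by (simp only: prime_dvd_mult_iff)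
  then show ?thesis
  proof
    assume "271 dvd e - 73"
    then obtain x where "e - 73 = 271 * x" by (rule dvdE)
    then have ex: "e = 271 * x + 73" by simp
    then have x: "x \<in> {0..46}" using \<open>0 < e\<close> \<open>e \<le> 12743\<close> by simp
    have quotients: "\<forall>x\<in>{0..46::int}. 469590030 mod (271 * x + 73) = 0 \<longrightarrow> False"
      by (simp add: simp_from_to)
    have "469590030 mod (271 * x + 73) = 0" using e_dvd by (simp only: ex)
    from mp[OF bspec[OF quotients x] this] show ?thesis by (rule FalseE)
  next
    assume "271 dvd e - 134"
    then obtain x where "e - 134 = 271 * x" by (rule dvdE)
    then have ex: "e = 271 * x + 134" by simp
    then have x: "x \<in> {0..46}" using \<open>0 < e\<close> \<open>e \<le> 12743\<close> by simp
    have quotients: "\<forall>x\<in>{0..46::int}. 469590030 mod (271 * x + 134) = 0 \<longrightarrow> False"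
      by (simp add: simp_from_to)
    have "469590030 mod (271 * x + 134) = 0" using e_dvd by (simp only: ex)
    from mp[OF bspec[OF quotients x] this] show ?thesis by (rule FalseE)
  qed
qed

section \<open>Integrality conditions on t\<close>

text \<open>Because \<open>36 * 36 > 1260\<close>, a divisor or its cofactor is at most 35, so it is
  enough to test that range.\<close>

lemma dvd_1260:
  fixes s :: int
  assumes "s dvd 1260" "3 \<le> s"
  shows "s \<in> {3, 4, 5, 6, 7, 9, 10, 12, 14, 15, 18, 20, 21, 28, 30, 35, 36,
    42, 45, 60, 63, 70, 84, 90, 105, 126, 140, 180, 210, 252, 315, 420, 630, 1260}"
proof -
  obtain e where e: "1260 = s * e" using assms(1) by (rule dvdE)
  then have "0 < e" using assms(2) zero_less_mult_pos[of s e] by simp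
  have *: "\<forall>j\<in>{1..35::int}. 1260 mod j = 0 \<longrightarrow>
    j \<in> {1, 2, 3, 4, 5, 6, 7, 9, 10, 12, 14, 15, 18, 20, 21, 28, 30, 35}"
    by (simp add: simp_from_to)
  show ?thesis
  proof (cases "s \<le> 35")
    case True
    then have "s \<in> {1, 2, 3, 4, 5, 6, 7, 9, 10, 12, 14, 15, 18, 20, 21, 28, 30, 35}"
      using assms * by (auto simp del: insert_iff simp: mod_eq_0_iff_dvd)
    then show ?thesis using assms(2) by auto
  next
    case False
    have "e \<le> 35"
    proof (rule ccontr)
      assume "\<not> e \<le> 35"
      then have "36 * 36 \<le> s * e" using False by (intro mult_mono) auto
      then show False using e by simp
    qed
    moreover have "e dvd 1260" unfolding e by simp
    ultimately have "e \<in> {1, 2, 3, 4, 5, 6, 7, 9, 10, 12, 14, 15, 18, 20, 21, 28, 30, 35}"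
      using \<open>0 < e\<close> * by (auto simp del: insert_iff simp: mod_eq_0_iff_dvd)
    then show ?thesis using e by auto
  qed
qed

text \<open>This is \<open>3 * c (k + 1)\<close> for \<open>b = 2\<close> and \<open>\<alpha> = t / 3\<close>.\<close>

definition scaled_c :: "int \<Rightarrow> nat \<Rightarrow> int" where
  "scaled_c t k = (2 ^ Suc k - 1) * (3 + t * (2 ^ k - 1))"

lemma scaled_c_prods:
  "(\<Prod>k<6. scaled_c t k) = scaled_c t 0 * scaled_c t 1 * scaled_c t 2 * scaled_c t 3 * scaled_c t 4 * scaled_c t 5"
  "(\<Prod>k<12. scaled_c t k) = (\<Prod>k<6. scaled_c t k) *
    (scaled_c t 6 * scaled_c t 7 * scaled_c t 8 * scaled_c t 9 * scaled_c t 10 * scaled_c t 11)"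
  by (simp_all add: lessThan_nat_numeral ac_simps)

text \<open>Here \<open>s\<close> stands for \<open>t + 3\<close> and the list is that of
  \<open>dvd_1260\<close>. For each candidate both products are explicit integers, so evaluation
  decides the divisibility.\<close>

lemma scaled_c_12:
  assumes "s \<in> {3, 4, 5, 6, 7, 9, 10, 12, 14, 15, 18, 20, 21, 28, 30, 35, 36,
    42, 45, 60, 63, 70, 84, 90, 105, 126, 140, 180, 210, 252, 315, 420, 630, 1260}"
    and "(\<Prod>k<6. scaled_c (s - 3) k) * (\<Prod>k<6. scaled_c (s - 3) k) dvd (\<Prod>k<12. scaled_c (s - 3) k)"
  shows "s \<in> {3, 4, 5, 6, 7, 9, 30}"
  using assms(1)
  by (elim insertE emptyE) (use assms(2)[unfolded scaled_c_prods] in \<open>simp_all add: scaled_c_def\<close>)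

lemma scaled_c_14:
  "\<not> (\<Prod>k<7. scaled_c 27 k) * (\<Prod>k<7. scaled_c 27 k) dvd (\<Prod>k<14. scaled_c 27 k)"
  by (simp add: scaled_c_def lessThan_nat_numeral)

text \<open>The factors are \<open>c (j + 1)\<close> and \<open>b j\<close> for \<open>D = 12\<close>, \<open>\<alpha> = 9\<close> and \<open>\<beta> = 128968\<close>.\<close>

lemma sphere_7:
  "\<not> (\<Prod>j<7. (2 ^ Suc j - 1) * (9 * 2 ^ j - 8)) dvd
    (\<Prod>j<7. (4096 - 2 ^ j) * (128977 - 9 * 2 ^ j) :: int)"
  by (simp add: lessThan_nat_numeral)

text \<open>Cancelling \<open>81 * (t + 3)\<close> leaves \<open>t + 3\<close> dividing
  \<open>35 * (t + 1) * (7 * t + 3)\<close>, and this polynomial takes the value 1260 at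
  \<open>t = -3\<close>.\<close>

lemma scaled_c_4:
  assumes "(\<Prod>k<2. scaled_c t k) * (\<Prod>k<2. scaled_c t k) dvd (\<Prod>k<4. scaled_c t k)" "0 \<le> t"
  shows "t + 3 dvd 1260"
proof -
  have "(81 * (t + 3)) * (t + 3) dvd (81 * (t + 3)) * (35 * (t + 1) * (7 * t + 3) :: int)"
    using assms(1) by (simp add: scaled_c_def lessThan_nat_numeral algebra_simps)
  then have "t + 3 dvd 35 * (t + 1) * (7 * t + 3)"
    using assms(2) by (subst (asm) dvd_mult_cancel_left) simp
  also have "35 * (t + 1) * (7 * t + 3) = (t + 3) * (35 * (7 * t - 11)) + 1260"
    by (simp add: algebra_simps)
  finally show ?thesis by (simp add: dvd_add_right_iff)
qed

section \<open>The trace of an idempotent matrix\<close>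

text \<open>By Schur decomposition the matrix is similar to an upper triangular one, which is again
  idempotent. Its diagonal entries equal their own squares, hence are 0 or 1, and similarity
  preserves the trace.\<close>

lemma idempotent_mat_trace_nat:
  fixes A :: "complex mat"
  assumes A: "A \<in> carrier_mat n n" and idem: "A * A = A"
  shows "(\<Sum>i<n. A $$ (i, i)) \<in> \<nat>"
proof -
  have trace_comm: "(\<Sum>i<n. (X * Y) $$ (i, i)) = (\<Sum>i<n. (Y * X) $$ (i, i))"
    if "X \<in> carrier_mat n n" "Y \<in> carrier_mat n n" for X Y :: "complex mat"
  proof -
    have "(\<Sum>i<n. (X * Y) $$ (i, i)) = (\<Sum>i<n. \<Sum>j<n. X $$ (i, j) * Y $$ (j, i))"
      using that by (simp add: scalar_prod_def lessThan_atLeast0)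
    also have "\<dots> = (\<Sum>j<n. \<Sum>i<n. Y $$ (j, i) * X $$ (i, j))"
      by (subst sum.swap) (simp add: mult.commute)
    also have "\<dots> = (\<Sum>i<n. (Y * X) $$ (i, i))"
      using that by (simp add: scalar_prod_def lessThan_atLeast0)
    finally show ?thesis .
  qed
  obtain B where B: "B \<in> carrier_mat n n" "upper_triangular B" "similar_mat A B"
    using char_poly_factorized[OF A] schur_decomposition_exists[OF A] by metis
  from B(3) obtain P Q where wit: "similar_mat_wit A B P Q"
    by (auto simp: similar_mat_def)
  from similar_mat_witD2[OF A wit]
  have P: "P \<in> carrier_mat n n" and Q: "Q \<in> carrier_mat n n"
    and QP: "Q * P = 1\<^sub>m n" and AB: "A = P * B * Q" by auto
  from similar_mat_witD2[OF B(1) similar_mat_wit_sym[OF wit]]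
  have BA: "B = Q * A * P" by auto
  have "A ^\<^sub>m 2 = A"
    using A idem by (simp add: numeral_2_eq_2)
  moreover have "B ^\<^sub>m 2 = Q * (A ^\<^sub>m 2) * P"
    by (rule similar_mat_wit_pow_id[OF similar_mat_wit_sym[OF wit]])
  ultimately have BB: "B * B = B"
    using BA B(1) by (simp add: numeral_2_eq_2)
  have diag: "B $$ (i, i) \<in> \<nat>" if i: "i < n" for i
  proof -
    have "B $$ (i, i) = (B * B) $$ (i, i)" unfolding BB ..
    also have "\<dots> = (\<Sum>j<n. B $$ (i, j) * B $$ (j, i))"
      using i B(1) by (simp add: scalar_prod_def lessThan_atLeast0)
    \<comment> \<open>For \<open>j \<noteq> i\<close> one of \<open>B $$ (i, j)\<close> and
      \<open>B $$ (j, i)\<close> lies below the diagonal and vanishes.\<close>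
    also have "\<dots> = (\<Sum>j<n. if j = i then B $$ (i, i) * B $$ (i, i) else 0)"
    proof (rule sum.cong[OF refl])
      fix j assume "j \<in> {..<n}"
      then show "B $$ (i, j) * B $$ (j, i) = (if j = i then B $$ (i, i) * B $$ (i, i) else 0)"
        using B(1,2) i by (cases i j rule: linorder_cases) (auto dest: upper_triangularD)
    qed
    also have "\<dots> = B $$ (i, i) * B $$ (i, i)" using i by simp
    finally show ?thesis by (metis mult_cancel_right1 Nats_0 Nats_1)
  qed
  have diag_sum: "(\<Sum>i\<in>I. B $$ (i, i)) \<in> \<nat>" if "I \<subseteq> {..<n}" for I
    using that by (induction I rule: infinite_finite_induct) (auto intro!: diag Nats_add)
  have "(\<Sum>i<n. A $$ (i, i)) = (\<Sum>i<n. (P * (B * Q)) $$ (i, i))"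
    using AB P Q B(1) by simp
  also have "\<dots> = (\<Sum>i<n. (B * Q * P) $$ (i, i))"
    by (rule trace_comm) (use P Q B(1) in auto)
  also have "B * Q * P = B"
    using QP P Q B(1) by simp
  finally show ?thesis
    using diag_sum[of "{..<n}"] by simp
qed

section \<open>Counting in distance-regular graphs\<close>

lemma sum_card_swap:
  assumes "finite A" "finite B"
  shows "(\<Sum>x\<in>A. card {y \<in> B. R x y}) = (\<Sum>y\<in>B. card {x \<in> A. R x y})"
  unfolding card_eq_sum sum.inter_filter[OF assms(1)] sum.inter_filter[OF assms(2)]
  by (rule sum.swap)

text \<open>The graph enters only through its metric, so walks are needed just to establish these
  axioms in \<open>drg_graph\<close>. Since \<open>d\<close> is bounded by \<open>D\<close>, nothing
  is required of \<open>b i\<close> and \<open>c i\<close> beyond \<open>i = D\<close>.\<close>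

locale drg =
  fixes V :: "'a set" and adj :: "'a \<Rightarrow> 'a \<Rightarrow> bool" and d :: "'a \<Rightarrow> 'a \<Rightarrow> nat"
    and D :: nat and b c :: "nat \<Rightarrow> int"
  assumes fin: "finite V"
    and d_eq_0: "x \<in> V \<Longrightarrow> y \<in> V \<Longrightarrow> d x y = 0 \<longleftrightarrow> x = y"
    and d_sym: "x \<in> V \<Longrightarrow> y \<in> V \<Longrightarrow> d x y = d y x"
    and d_triangle: "x \<in> V \<Longrightarrow> y \<in> V \<Longrightarrow> z \<in> V \<Longrightarrow> d x z \<le> d x y + d y z"
    and adj_iff: "x \<in> V \<Longrightarrow> y \<in> V \<Longrightarrow> adj x y \<longleftrightarrow> d x y = 1"
    and d_pred: "x \<in> V \<Longrightarrow> y \<in> V \<Longrightarrow> d x y = Suc i \<Longrightarrow> \<exists>z\<in>V. adj y z \<and> d x z = i"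
    and d_le: "x \<in> V \<Longrightarrow> y \<in> V \<Longrightarrow> d x y \<le> D"
    and d_attained: "\<exists>x\<in>V. \<exists>y\<in>V. d x y = D"
    and card_c: "x \<in> V \<Longrightarrow> y \<in> V \<Longrightarrow>
      int (card {z \<in> V. adj y z \<and> d x z + 1 = d x y}) = c (d x y)"
    and card_b: "x \<in> V \<Longrightarrow> y \<in> V \<Longrightarrow>
      int (card {z \<in> V. adj y z \<and> d x z = d x y + 1}) = b (d x y)"
begin

section \<open>Intersection numbers, intervals and spheres\<close>

lemma adj_sym: "x \<in> V \<Longrightarrow> y \<in> V \<Longrightarrow> adj x y \<longleftrightarrow> adj y x"
  using adj_iff d_sym by simp

lemma adj_dist:
  assumes "x \<in> V" "y \<in> V" "z \<in> V" "adj y z"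
  shows "d x z \<le> d x y + 1" "d x y \<le> d x z + 1"
  using assms d_triangle[of x y z] d_triangle[of x z y] adj_iff d_sym[of y z] by auto

lemma ex_dist:
  assumes "i \<le> D"
  shows "\<exists>x\<in>V. \<exists>y\<in>V. d x y = i"
  using assms
proof (induction i rule: inc_induct)
  case base
  show ?case by (rule d_attained)
next
  case (step i)
  then show ?case using d_pred by blast
qed

lemma c_pos: assumes "0 < i" "i \<le> D" shows "0 < c i"
proof -
  obtain x y where xy: "x \<in> V" "y \<in> V" "d x y = i" using ex_dist assms by blast
  then obtain z where "z \<in> V" "adj y z" "d x z + 1 = i"
    using d_pred[of x y "i - 1"] assms by auto
  then have "{z \<in> V. adj y z \<and> d x z + 1 = d x y} \<noteq> {}" using xy by auto
  then have "0 < card {z \<in> V. adj y z \<and> d x z + 1 = d x y}"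
    using fin by (simp add: card_gt_0_iff)
  then show ?thesis using card_c[OF xy(1,2)] xy(3) by simp
qed

lemma b_pos: assumes "i < D" shows "0 < b i"
proof -
  obtain x y where xy: "x \<in> V" "y \<in> V" "d x y = Suc i" using ex_dist[of "Suc i"] assms by auto
  then obtain z where z: "z \<in> V" "adj y z" "d x z = i" using d_pred by blast
  then have "{w \<in> V. adj z w \<and> d x w = d x z + 1} \<noteq> {}" using xy adj_sym by auto
  then have "0 < card {w \<in> V. adj z w \<and> d x w = d x z + 1}"
    using fin by (simp add: card_gt_0_iff)
  then show ?thesis using card_b[OF xy(1) z(1)] z(3) by simp
qed

lemma c_0: "c 0 = 0"
proof -
  obtain x where "x \<in> V" using d_attained by blast
  then show ?thesis using card_c[of x x] d_eq_0[of x x] by simp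
qed

lemma b_D: "b D = 0"
proof -
  obtain x y where xy: "x \<in> V" "y \<in> V" "d x y = D" using d_attained by blast
  have "{z \<in> V. adj y z \<and> d x z = d x y + 1} = {}"
    using xy d_le[OF xy(1)] by force
  with card_b[OF xy(1,2)] xy(3) show ?thesis by (metis card.empty of_nat_0)
qed

lemma degree: assumes "x \<in> V" shows "int (card {z \<in> V. adj x z}) = b 0"
proof -
  have "{z \<in> V. adj x z \<and> d x z = d x x + 1} = {z \<in> V. adj x z}"
    using adj_iff[OF assms] d_eq_0[OF assms assms] by auto
  with card_b[OF assms assms] show ?thesis using d_eq_0[OF assms assms] by simp
qed

definition a :: "nat \<Rightarrow> int" where
  "a i = b 0 - b i - c i"

lemma nbrs_split:
  assumes "x \<in> V" "y \<in> V"
  shows "{z \<in> V. adj y z} = {z \<in> V. adj y z \<and> d x z + 1 = d x y} \<union>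
    {z \<in> V. adj y z \<and> d x z = d x y} \<union> {z \<in> V. adj y z \<and> d x z = d x y + 1}"
proof -
  have "d x z + 1 = d x y \<or> d x z = d x y \<or> d x z = d x y + 1" if "z \<in> V" "adj y z" for z
    using adj_dist[OF assms that] by linarith
  then show ?thesis by blast
qed

lemma card_a:
  assumes "x \<in> V" "y \<in> V"
  shows "int (card {z \<in> V. adj y z \<and> d x z = d x y}) = a (d x y)"
proof -
  let ?C = "{z \<in> V. adj y z \<and> d x z + 1 = d x y}"
    and ?A = "{z \<in> V. adj y z \<and> d x z = d x y}"
    and ?B = "{z \<in> V. adj y z \<and> d x z = d x y + 1}"
  have "card (?C \<union> ?A) = card ?C + card ?A"
    by (rule card_Un_disjoint) (use fin in auto)
  moreover have "card (?C \<union> ?A \<union> ?B) = card (?C \<union> ?A) + card ?B"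
    by (rule card_Un_disjoint) (use fin in auto)
  ultimately have "card {z \<in> V. adj y z} = card ?C + card ?A + card ?B"
    using nbrs_split[OF assms] by simp
  then show ?thesis
    using degree[OF assms(2)] card_b[OF assms] card_c[OF assms] by (simp add: a_def)
qed

text \<open>The adjacency operator acts on functions of the distance from \<open>x\<close> as a
  tridiagonal matrix. For \<open>x = y\<close> the truncated index \<open>d x y - 1\<close> is
  harmless, as \<open>c 0 = 0\<close>.\<close>

lemma sum_nbrs:
  fixes q :: "nat \<Rightarrow> real"
  assumes "x \<in> V" "y \<in> V"
  shows "(\<Sum>z \<in> {z \<in> V. adj y z}. q (d x z)) =
    c (d x y) * q (d x y - 1) + a (d x y) * q (d x y) + b (d x y) * q (d x y + 1)"
proof -
  let ?C = "{z \<in> V. adj y z \<and> d x z + 1 = d x y}"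
    and ?A = "{z \<in> V. adj y z \<and> d x z = d x y}"
    and ?B = "{z \<in> V. adj y z \<and> d x z = d x y + 1}"
  have "(\<Sum>z\<in>?C \<union> ?A. q (d x z)) = (\<Sum>z\<in>?C. q (d x z)) + (\<Sum>z\<in>?A. q (d x z))"
    by (rule sum.union_disjoint) (use fin in auto)
  moreover have "(\<Sum>z\<in>?C \<union> ?A \<union> ?B. q (d x z)) =
    (\<Sum>z\<in>?C \<union> ?A. q (d x z)) + (\<Sum>z\<in>?B. q (d x z))"
    by (rule sum.union_disjoint) (use fin in auto)
  ultimately have "(\<Sum>z \<in> {z \<in> V. adj y z}. q (d x z)) =
    (\<Sum>z\<in>?C. q (d x z)) + (\<Sum>z\<in>?A. q (d x z)) + (\<Sum>z\<in>?B. q (d x z))"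
    unfolding nbrs_split[OF assms] by simp
  also have "(\<Sum>z\<in>?C. q (d x z)) = (\<Sum>z\<in>?C. q (d x y - 1))"
  proof (rule sum.cong[OF refl])
    fix z assume "z \<in> ?C"
    then have "d x z + 1 = d x y" by blast
    then have "d x z = d x y - 1" by linarith
    then show "q (d x z) = q (d x y - 1)" by simp
  qed
  also have "(\<Sum>z\<in>?A. q (d x z)) = (\<Sum>z\<in>?A. q (d x y))"
    by (rule sum.cong) auto
  also have "(\<Sum>z\<in>?B. q (d x z)) = (\<Sum>z\<in>?B. q (d x y + 1))"
    by (rule sum.cong) auto
  finally show ?thesis
    using card_a[OF assms, symmetric] card_b[OF assms, symmetric] card_c[OF assms, symmetric]
    by simp
qed

text \<open>
  Induction on \<open>i\<close>, counting the edges between consecutive levels of the interval from \<open>x\<close> to \<open>y\<close>.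
\<close>

lemma card_geodesic:
  assumes "x \<in> V" "y \<in> V" "i \<le> d x y"
  shows "int (card {z \<in> V. d x z = i \<and> d z y = d x y - i}) *
    (\<Prod>j<i. c (Suc j)) * (\<Prod>j<d x y - i. c (Suc j)) = (\<Prod>j<d x y. c (Suc j))"
  using assms(3)
proof (induction i)
  case 0
  have "{z \<in> V. d x z = 0 \<and> d z y = d x y - 0} = {x}"
    using assms d_eq_0 by auto
  then show ?case by simp
next
  case (Suc i)
  define h where "h = d x y"
  let ?S = "\<lambda>i. {z \<in> V. d x z = i \<and> d z y = h - i}"
  have hi: "h - i = Suc (h - Suc i)" using Suc.prems by (simp add: h_def)
  \<comment> \<open>A neighbour of \<open>z\<close> one step closer to \<open>y\<close> has distance
    at most \<open>i + 1\<close> from \<open>x\<close> through \<open>z\<close>, and at least that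
    because \<open>x\<close> and \<open>y\<close> are \<open>h\<close> apart; so it lies on the next
    level. The argument for \<open>inn\<close> is the mirror image.\<close>
  have out: "int (card {w \<in> ?S (Suc i). adj z w}) = c (h - i)" if "z \<in> ?S i" for z
  proof -
    have "{w \<in> ?S (Suc i). adj z w} = {w \<in> V. adj z w \<and> d y w + 1 = d y z}"
    proof (intro equalityI subsetI)
      fix w assume w: "w \<in> {w \<in> V. adj z w \<and> d y w + 1 = d y z}"
      then have "d x w \<le> i + 1" using that assms adj_dist(1)[of x z w] by simp
      moreover have "h \<le> d x w + d w y" unfolding h_def using assms w d_triangle by simp
      moreover have "d w y = h - Suc i" using w that hi d_sym assms by auto
      ultimately show "w \<in> {w \<in> ?S (Suc i). adj z w}" using w Suc.prems by (auto simp: h_def)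
    next
      fix w assume "w \<in> {w \<in> ?S (Suc i). adj z w}"
      then show "w \<in> {w \<in> V. adj z w \<and> d y w + 1 = d y z}"
        using that hi d_sym assms by auto
    qed
    then show ?thesis using card_c[of y z] that assms d_sym[of y z] by simp
  qed
  have inn: "int (card {z \<in> ?S i. adj z w}) = c (Suc i)" if "w \<in> ?S (Suc i)" for w
  proof -
    have "{z \<in> ?S i. adj z w} = {z \<in> V. adj w z \<and> d x z + 1 = d x w}"
    proof (intro equalityI subsetI)
      fix z assume z: "z \<in> {z \<in> V. adj w z \<and> d x z + 1 = d x w}"
      have "d y z \<le> d y w + 1" using z that assms adj_dist(1)[of y w z] by simp
      then have "d z y \<le> h - i" using that hi d_sym assms z by auto
      moreover have "h \<le> d x z + d z y" unfolding h_def using assms z d_triangle by simp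
      ultimately show "z \<in> {z \<in> ?S i. adj z w}"
        using z that Suc.prems adj_sym by (auto simp: h_def)
    next
      fix z assume "z \<in> {z \<in> ?S i. adj z w}"
      then show "z \<in> {z \<in> V. adj w z \<and> d x z + 1 = d x w}"
        using that adj_sym by auto
    qed
    then show ?thesis using card_c[of x w] that assms by simp
  qed
  have "(\<Sum>z\<in>?S i. int (card {w \<in> ?S (Suc i). adj z w})) =
    (\<Sum>w\<in>?S (Suc i). int (card {z \<in> ?S i. adj z w}))"
    using sum_card_swap[of "?S i" "?S (Suc i)" adj] fin
    by (simp flip: of_nat_sum)
  then have step: "int (card (?S i)) * c (h - i) = int (card (?S (Suc i))) * c (Suc i)"
    using out inn by simp
  have IH: "int (card (?S i)) * (\<Prod>j<i. c (Suc j)) * (\<Prod>j<h - i. c (Suc j)) =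
    (\<Prod>j<h. c (Suc j))"
    using Suc by (simp add: h_def)
  have "(\<Prod>j<h - i. c (Suc j)) = (\<Prod>j<h - Suc i. c (Suc j)) * c (h - i)"
    unfolding hi by simp
  with IH have "int (card (?S i)) * c (h - i) * (\<Prod>j<i. c (Suc j)) * (\<Prod>j<h - Suc i. c (Suc j)) =
    (\<Prod>j<h. c (Suc j))"
    by (simp add: ac_simps)
  then have "int (card (?S (Suc i))) * (\<Prod>j<Suc i. c (Suc j)) *
    (\<Prod>j<h - Suc i. c (Suc j)) = (\<Prod>j<h. c (Suc j))"
    unfolding step by (simp add: ac_simps)
  then show ?case unfolding h_def .
qed

lemma prod_c_dvd:
  assumes "i + j \<le> D"
  shows "(\<Prod>k<i. c (Suc k)) * (\<Prod>k<j. c (Suc k)) dvd (\<Prod>k<i + j. c (Suc k))"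
proof -
  obtain x y where "x \<in> V" "y \<in> V" "d x y = i + j" using ex_dist[OF assms] by blast
  with card_geodesic[of x y i] have "(\<Prod>k<i + j. c (Suc k)) =
    (\<Prod>k<i. c (Suc k)) * (\<Prod>k<j. c (Suc k)) * int (card {z \<in> V. d x z = i \<and> d z y = j})"
    by (simp add: ac_simps)
  then show ?thesis by (rule dvdI)
qed

text \<open>Both sides count the edges between the spheres of radius \<open>i\<close> and
  \<open>Suc i\<close> around \<open>x\<close>.\<close>

lemma card_sphere_step:
  assumes "x \<in> V"
  shows "int (card {z \<in> V. d x z = i}) * b i = int (card {z \<in> V. d x z = Suc i}) * c (Suc i)"
proof -
  let ?S = "\<lambda>i. {z \<in> V. d x z = i}"
  have "int (card {w \<in> ?S (Suc i). adj z w}) = b i" if "z \<in> ?S i" for z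
  proof -
    have "{w \<in> ?S (Suc i). adj z w} = {w \<in> V. adj z w \<and> d x w = d x z + 1}"
      using that by auto
    then show ?thesis using card_b[of x z] that assms by simp
  qed
  moreover have "int (card {z \<in> ?S i. adj z w}) = c (Suc i)" if "w \<in> ?S (Suc i)" for w
  proof -
    have "{z \<in> ?S i. adj z w} = {z \<in> V. adj w z \<and> d x z + 1 = d x w}"
      using that adj_sym by auto
    then show ?thesis using card_c[of x w] that assms by simp
  qed
  moreover have "(\<Sum>z\<in>?S i. int (card {w \<in> ?S (Suc i). adj z w})) =
    (\<Sum>w\<in>?S (Suc i). int (card {z \<in> ?S i. adj z w}))"
    using sum_card_swap[of "?S i" "?S (Suc i)" adj] fin
    by (simp flip: of_nat_sum)
  ultimately show ?thesis
    by simp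
qed

lemma card_sphere:
  assumes "x \<in> V" "i \<le> D"
  shows "int (card {z \<in> V. d x z = i}) * (\<Prod>j<i. c (Suc j)) = (\<Prod>j<i. b j)"
  using assms(2)
proof (induction i)
  case 0
  have "{z \<in> V. d x z = 0} = {x}" using assms d_eq_0 by auto
  then show ?case by simp
next
  case (Suc i)
  have "int (card {z \<in> V. d x z = Suc i}) * (\<Prod>j<Suc i. c (Suc j)) =
    int (card {z \<in> V. d x z = Suc i}) * c (Suc i) * (\<Prod>j<i. c (Suc j))"
    by simp
  also have "\<dots> = int (card {z \<in> V. d x z = i}) * (\<Prod>j<i. c (Suc j)) * b i"
    by (simp flip: card_sphere_step[OF assms(1)])
  also have "\<dots> = (\<Prod>j<Suc i. b j)"
    using Suc by simp
  finally show ?case .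
qed

lemma card_sphere_indep:
  assumes "x \<in> V" "y \<in> V" "i \<le> D"
  shows "card {z \<in> V. d x z = i} = card {z \<in> V. d y z = i}"
proof -
  have "0 < (\<Prod>j<i. c (Suc j))"
    by (rule prod_pos) (use c_pos assms(3) in simp)
  then have nz: "(\<Prod>j<i. c (Suc j)) \<noteq> 0"
    by (rule less_imp_neq[symmetric])
  have "int (card {z \<in> V. d x z = i}) * (\<Prod>j<i. c (Suc j)) =
    int (card {z \<in> V. d y z = i}) * (\<Prod>j<i. c (Suc j))"
    using card_sphere[OF assms(1,3)] card_sphere[OF assms(2,3)] by simp
  then have "int (card {z \<in> V. d x z = i}) = int (card {z \<in> V. d y z = i})"
    using mult_right_cancel[OF nz] by blast
  then show ?thesis by (simp only: of_nat_eq_iff)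
qed

section \<open>Eigenfunctions of the distance and their multiplicities\<close>

lemma sum_spheres:
  assumes "x \<in> V"
  shows "(\<Sum>z\<in>V. g z) = (\<Sum>i\<le>D. \<Sum>z\<in>{z \<in> V. d x z = i}. g z)"
  by (rule sum.group[symmetric]) (use fin d_le[OF assms] in auto)

text \<open>This is the product of the adjacency matrix with the distance-\<open>i\<close> matrix,
  applied to \<open>f\<close>. The weight of \<open>f z\<close> is the number of neighbours of
  \<open>x\<close> at distance \<open>i\<close> from \<open>z\<close>, which \<open>sum_nbrs\<close>
  computes with an indicator function.\<close>

lemma sphere_sum_rec:
  fixes f :: "'a \<Rightarrow> real"
  assumes x: "x \<in> V"
  shows "(\<Sum>w\<in>{w \<in> V. adj x w}. \<Sum>z\<in>{z \<in> V. d w z = i}. f z) =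
    c (Suc i) * (\<Sum>z\<in>{z \<in> V. d x z = Suc i}. f z) + a i * (\<Sum>z\<in>{z \<in> V. d x z = i}. f z) +
    (if i = 0 then 0 else b (i - 1) * (\<Sum>z\<in>{z \<in> V. d x z = i - 1}. f z))"
proof -
  let ?N = "{w \<in> V. adj x w}"
  have "(\<Sum>w\<in>?N. \<Sum>z\<in>{z \<in> V. d w z = i}. f z) = (\<Sum>w\<in>?N. \<Sum>z\<in>V. f z * of_bool (d z w = i))"
  proof (rule sum.cong[OF refl])
    fix w assume w: "w \<in> ?N"
    have "(\<Sum>z\<in>{z \<in> V. d w z = i}. f z) = (\<Sum>z\<in>V. if d w z = i then f z else 0)"
      by (rule sum.inter_filter[OF fin])
    also have "\<dots> = (\<Sum>z\<in>V. f z * of_bool (d z w = i))"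
      using w by (intro sum.cong) (auto simp: d_sym)
    finally show "(\<Sum>z\<in>{z \<in> V. d w z = i}. f z) = (\<Sum>z\<in>V. f z * of_bool (d z w = i))" .
  qed
  also have "\<dots> = (\<Sum>z\<in>V. f z * (\<Sum>w\<in>?N. of_bool (d z w = i)))"
    by (subst sum.swap) (simp add: sum_distrib_left)
  also have "\<dots> = (\<Sum>z\<in>V. (if d x z = Suc i then c (Suc i) * f z else 0) +
    (if d x z = i then a i * f z else 0) +
    (if d x z + 1 = i then b (i - 1) * f z else 0))"
  proof (rule sum.cong[OF refl])
    fix z assume z: "z \<in> V"
    show "f z * (\<Sum>w\<in>?N. of_bool (d z w = i)) =
      (if d x z = Suc i then c (Suc i) * f z else 0) + (if d x z = i then a i * f z else 0) +
      (if d x z + 1 = i then b (i - 1) * f z else 0)"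
      unfolding sum_nbrs[OF z x, of "\<lambda>j. of_bool (j = i)"] d_sym[OF z x]
      using c_0 by (cases "d x z") auto
  qed
  also have "\<dots> = c (Suc i) * (\<Sum>z\<in>{z \<in> V. d x z = Suc i}. f z) +
    a i * (\<Sum>z\<in>{z \<in> V. d x z = i}. f z) + b (i - 1) * (\<Sum>z\<in>{z \<in> V. d x z + 1 = i}. f z)"
    using fin by (simp add: sum.distrib sum_distrib_left flip: sum.inter_filter)
  also have "b (i - 1) * (\<Sum>z\<in>{z \<in> V. d x z + 1 = i}. f z) =
    (if i = 0 then 0 else b (i - 1) * (\<Sum>z\<in>{z \<in> V. d x z = i - 1}. f z))"
    by (cases i) auto
  finally show ?thesis .
qed

text \<open>\<open>u\<close> is the cosine sequence of the eigenvalue \<open>\<theta>\<close>. The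
  out-of-range values at both ends do not matter, being multiplied by \<open>c 0 = 0\<close> and
  \<open>b D = 0\<close>.\<close>

context
  fixes u :: "nat \<Rightarrow> real" and \<theta> :: real
  assumes u_0: "u 0 = 1"
    and u_rec: "i \<le> D \<Longrightarrow> c i * u (i - 1) + a i * u i + b i * u (i + 1) = \<theta> * u i"
begin

text \<open>The function \<open>u (d y z)\<close> of \<open>z\<close> is an eigenvector of the
  adjacency matrix, and every distance matrix is a polynomial in that matrix, so it acts on the
  function by a scalar. The induction runs along the three-term recurrence, with \<open>x\<close>
  arbitrary because it is applied at the neighbours of \<open>x\<close>.\<close>

lemma sphere_sum_u:
  assumes "i \<le> D" "x \<in> V" "y \<in> V"
  shows "(\<Sum>z\<in>{z \<in> V. d x z = i}. u (d y z)) = card {z \<in> V. d x z = i} * u i * u (d y x)"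
  using assms(1,2)
proof (induction i arbitrary: x rule: less_induct)
  case (less i)
  show ?case
  proof (cases i)
    case 0
    have "{z \<in> V. d x z = 0} = {x}" using less.prems d_eq_0 by auto
    then show ?thesis using 0 u_0 by simp
  next
    case (Suc j)
    let ?K = "\<lambda>i. real (card {z \<in> V. d x z = i})"
      and ?F = "\<lambda>i. \<Sum>z\<in>{z \<in> V. d x z = i}. u (d y z)"
    have j: "j \<le> D" "j < i" using less.prems Suc by auto
    have K: "?K j * b j = ?K (Suc j) * c (Suc j)" for j
      using arg_cong[OF card_sphere_step[OF less.prems(2), of j], of real_of_int] by simp
    \<comment> \<open>The sum over the radius \<open>j\<close> spheres around all neighbours of
      \<open>x\<close> is evaluated twice: by the induction hypothesis at those neighbours, and by
      \<open>sphere_sum_rec\<close>, which brings in radius \<open>Suc j\<close>.\<close>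
    have "(\<Sum>w\<in>{w \<in> V. adj x w}. \<Sum>z\<in>{z \<in> V. d w z = j}. u (d y z)) =
      (\<Sum>w\<in>{w \<in> V. adj x w}. ?K j * u j * u (d y w))"
    proof (rule sum.cong[OF refl])
      fix w assume w: "w \<in> {w \<in> V. adj x w}"
      then have "w \<in> V" by simp
      from less.IH[OF j(2,1) this] card_sphere_indep[OF this less.prems(2) j(1)]
      show "(\<Sum>z\<in>{z \<in> V. d w z = j}. u (d y z)) = ?K j * u j * u (d y w)" by simp
    qed
    also have "\<dots> = ?K j * u j * (\<Sum>w\<in>{w \<in> V. adj x w}. u (d y w))"
      by (rule sum_distrib_left[symmetric])
    also have "(\<Sum>w\<in>{w \<in> V. adj x w}. u (d y w)) = \<theta> * u (d y x)"
      using sum_nbrs[OF assms(3) less.prems(2), of u] u_rec[OF d_le[OF assms(3) less.prems(2)]]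
      by simp
    finally have main: "c (Suc j) * ?F (Suc j) + a j * ?F j +
      (if j = 0 then 0 else b (j - 1) * ?F (j - 1)) = ?K j * u j * \<theta> * u (d y x)"
      unfolding sphere_sum_rec[OF less.prems(2)] by simp
    have Fj: "?F j = ?K j * u j * u (d y x)" using less.IH[OF j(2,1) less.prems(2)] .
    have "(if j = 0 then 0 else b (j - 1) * ?F (j - 1)) = ?K j * c j * u (j - 1) * u (d y x)"
    proof (cases j)
      case 0
      then show ?thesis using c_0 by simp
    next
      case (Suc k)
      then have "?F k = ?K k * u k * u (d y x)" using less.IH[of k x] less.prems j by simp
      then have "b k * ?F k = (?K k * b k) * u k * u (d y x)" by simp
      then show ?thesis using K[of k] Suc by simp
    qed
    with main Fj have "c (Suc j) * ?F (Suc j) =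
      ?K j * u (d y x) * (\<theta> * u j - a j * u j - c j * u (j - 1))"
      by (simp add: algebra_simps)
    also have "\<theta> * u j - a j * u j - c j * u (j - 1) = b j * u (Suc j)"
      using u_rec[OF j(1)] by simp
    also have "?K j * u (d y x) * (b j * u (Suc j)) = (?K j * b j) * u (Suc j) * u (d y x)"
      by simp
    also have "?K j * b j = ?K (Suc j) * c (Suc j)"
      by (rule K)
    finally have "c (Suc j) * ?F (Suc j) = c (Suc j) * (?K (Suc j) * u (Suc j) * u (d y x))"
      by (simp add: ac_simps)
    moreover have "real_of_int (c (Suc j)) \<noteq> 0" using c_pos[of "Suc j"] less.prems Suc by simp
    note mult_left_cancel[OF this]
    ultimately show ?thesis unfolding Suc by blast
  qed
qed

text \<open>Grouping \<open>z\<close> by its distance from \<open>x\<close> reduces the sum to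
  \<open>sphere_sum_u\<close>. Sphere sizes do not depend on the centre, so the factor can be
  computed at any \<open>w\<close>.\<close>

lemma sum_u_conv:
  assumes "x \<in> V" "y \<in> V" "w \<in> V"
  shows "(\<Sum>z\<in>V. u (d x z) * u (d z y)) = (\<Sum>z\<in>V. (u (d w z))\<^sup>2) * u (d x y)"
proof -
  have "(\<Sum>z\<in>V. u (d x z) * u (d z y)) = (\<Sum>z\<in>V. u (d x z) * u (d y z))"
    using d_sym assms by (intro sum.cong) auto
  also have "\<dots> = (\<Sum>i\<le>D. u i * (\<Sum>z\<in>{z \<in> V. d x z = i}. u (d y z)))"
    unfolding sum_spheres[OF assms(1)] by (simp add: sum_distrib_left)
  also have "\<dots> = (\<Sum>i\<le>D. card {z \<in> V. d w z = i} * (u i)\<^sup>2 * u (d x y))"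
    using sphere_sum_u[OF _ assms(1,2)] d_sym[OF assms(1,2)] card_sphere_indep[OF assms(1,3)]
    by (intro sum.cong) (auto simp: power2_eq_square)
  also have "\<dots> = (\<Sum>i\<le>D. card {z \<in> V. d w z = i} * (u i)\<^sup>2) * u (d x y)"
    by (simp add: sum_distrib_right)
  also have "(\<Sum>i\<le>D. card {z \<in> V. d w z = i} * (u i)\<^sup>2) = (\<Sum>z\<in>V. (u (d w z))\<^sup>2)"
    unfolding sum_spheres[OF assms(3)] by simp
  finally show ?thesis .
qed

text \<open>
  By \<open>sum_u_conv\<close> the matrix \<open>u (d x y) / S\<close> with \<open>S = (\<Sum>z. (u (d x z))\<^sup>2)\<close> is idempotent, so its
  trace \<open>card V / S\<close> is a natural number. The function \<open>q\<close> evaluates \<open>S\<close>: the Laplacian of \<open>q\<close>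
  sums to zero over the graph, hence \<open>m * S = card V\<close>.
\<close>

lemma multiplicity_nat:
  fixes q :: "nat \<Rightarrow> real" and m :: real
  assumes q: "\<And>i. i \<le> D \<Longrightarrow> c i * (q (i - 1) - q i) + b i * (q (i + 1) - q i) = m * (u i)\<^sup>2 - 1"
  shows "m \<in> \<nat>"
proof -
  obtain x where x: "x \<in> V" using d_attained by blast
  define S where "S = (\<Sum>z\<in>V. (u (d x z))\<^sup>2)"
  have "(\<Sum>z\<in>V. \<Sum>w\<in>{w \<in> V. adj z w}. q (d x w)) = (\<Sum>z\<in>V. \<Sum>w\<in>V. if adj z w then q (d x w) else 0)"
    using fin by (simp add: sum.inter_filter)
  also have "\<dots> = (\<Sum>w\<in>V. \<Sum>z\<in>V. if adj w z then q (d x w) else 0)"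
    by (subst sum.swap) (auto intro!: sum.cong simp: adj_sym)
  also have "\<dots> = (\<Sum>w\<in>V. b 0 * q (d x w))"
  proof (rule sum.cong[OF refl])
    fix w assume "w \<in> V"
    then have "real (card {z \<in> V. adj w z}) = b 0" using degree by (metis of_int_of_nat_eq)
    then show "(\<Sum>z\<in>V. if adj w z then q (d x w) else 0) = b 0 * q (d x w)"
      using fin by (simp flip: sum.inter_filter)
  qed
  finally have "0 = (\<Sum>z\<in>V. (\<Sum>w\<in>{w \<in> V. adj z w}. q (d x w)) - b 0 * q (d x z))"
    by (simp add: sum_subtractf)
  also have "\<dots> = (\<Sum>z\<in>V. m * (u (d x z))\<^sup>2 - 1)"
  proof (rule sum.cong[OF refl])
    fix z assume z: "z \<in> V"
    show "(\<Sum>w\<in>{w \<in> V. adj z w}. q (d x w)) - b 0 * q (d x z) = m * (u (d x z))\<^sup>2 - 1"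
      unfolding q[OF d_le[OF x z], symmetric] sum_nbrs[OF x z] a_def by (simp add: algebra_simps)
  qed
  also have "\<dots> = m * S - card V"
    by (simp add: sum_subtractf S_def sum_distrib_left)
  finally have mS: "m * S = card V" by simp
  have "S \<noteq> 0" using mS x fin by (auto simp: card_gt_0_iff)
  obtain v where v: "bij_betw v {0..<card V} V" using ex_bij_betw_nat_finite[OF fin] by blast
  define E where "E = mat (card V) (card V) (\<lambda>(i, j). complex_of_real (u (d (v i) (v j)) / S))"
  have vV: "v i \<in> V" if "i < card V" for i using v that by (auto simp: bij_betw_def)
  have "E * E = E"
  proof (rule eq_matI)
    fix i j assume "i < dim_row E" "j < dim_col E"
    then have ij: "i < card V" "j < card V" by (auto simp: E_def)
    have "(E * E) $$ (i, j) =
      complex_of_real (\<Sum>k\<in>{0..<card V}. u (d (v i) (v k)) * u (d (v k) (v j)) / (S * S))"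
      using ij by (simp add: E_def scalar_prod_def)
    also have "(\<Sum>k\<in>{0..<card V}. u (d (v i) (v k)) * u (d (v k) (v j)) / (S * S)) =
      (\<Sum>z\<in>V. u (d (v i) z) * u (d z (v j)) / (S * S))"
      by (rule sum.reindex_bij_betw[OF v])
    also have "\<dots> = (\<Sum>z\<in>V. u (d (v i) z) * u (d z (v j))) / (S * S)"
      by (simp add: sum_divide_distrib)
    also have "\<dots> = u (d (v i) (v j)) / S"
      using sum_u_conv[OF vV[OF ij(1)] vV[OF ij(2)] x] \<open>S \<noteq> 0\<close> by (simp add: S_def)
    finally show "(E * E) $$ (i, j) = E $$ (i, j)" using ij by (simp add: E_def)
  qed (auto simp: E_def)
  then have "(\<Sum>i<card V. E $$ (i, i)) \<in> \<nat>"
    by (intro idempotent_mat_trace_nat) (auto simp: E_def)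
  also have "(\<Sum>i<card V. E $$ (i, i)) = (\<Sum>i<card V. complex_of_real (1 / S))"
  proof (rule sum.cong[OF refl])
    fix i assume "i \<in> {..<card V}"
    then show "E $$ (i, i) = complex_of_real (1 / S)"
      using d_eq_0[OF vV vV, of i i] u_0 by (simp add: E_def)
  qed
  also have "\<dots> = complex_of_real (real (card V) * (1 / S))"
    by simp
  also have "real (card V) * (1 / S) = m"
    using mS \<open>S \<noteq> 0\<close> by (simp add: field_simps)
  finally obtain k where "complex_of_real m = of_nat k"
    by (rule Nats_cases)
  then have "m = real k"
    by (metis of_real_eq_iff of_real_of_nat_eq)
  then show ?thesis by simp
qed

end

end

section \<open>The distance of a connected graph\<close>

context graph
begin

lemma awalk_reverse:
  assumes "awalk u p v"
  shows "\<exists>q. awalk v q u \<and> length q = length p"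
  using assms
proof (induction p arbitrary: u)
  case Nil
  then show ?case by (auto simp: awalk_Nil_iff)
next
  case (Cons e p)
  then have e: "e \<in> arcs G" "u = tail G e" and "awalk (head G e) p v"
    by (auto simp: awalk_Cons_iff)
  with Cons.IH obtain q where q: "awalk v q (head G e)" "length q = length p" by blast
  from sym_arcs e(1) obtain e' where e': "e' \<in> arcs G" "tail G e = head G e'" "head G e = tail G e'"
    unfolding symmetric_conv by blast
  then have "awalk (head G e) [e'] u"
    using e(2) arc_implies_awalk[OF e'(1)] by simp
  with q show ?case
    using awalk_appendI[OF q(1)] by (intro exI[of _ "q @ [e']"]) simp
qed

lemma graph_dist_le: "awalk u p v \<Longrightarrow> graph_dist G u v \<le> length p"
  unfolding graph_dist_def by (rule Least_le) blast

context
  assumes conn: "connected G"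
begin

lemma ex_geodesic:
  assumes "u \<in> verts G" "v \<in> verts G"
  shows "\<exists>p. awalk u p v \<and> length p = graph_dist G u v"
proof -
  have "strongly_connected G"
    using conn by (intro symmetric_connected_imp_strongly_connected sym_arcs)
  then obtain p where "awalk u p v"
    using assms by (auto simp: strongly_connected_def reachable_awalk)
  then show ?thesis unfolding graph_dist_def by - (rule LeastI_ex, blast)
qed

lemma graph_dist_sym:
  assumes "u \<in> verts G" "v \<in> verts G"
  shows "graph_dist G u v = graph_dist G v u"
proof (rule antisym)
  have "graph_dist G x y \<le> graph_dist G y x" if xy: "x \<in> verts G" "y \<in> verts G" for x y
  proof -
    obtain p where "awalk y p x" "length p = graph_dist G y x"
      using ex_geodesic[OF xy(2,1)] by blast
    with awalk_reverse[of y p x] obtain q where "awalk x q y" "length q = graph_dist G y x"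
      by auto
    with graph_dist_le[of x q y] show ?thesis by simp
  qed
  then show "graph_dist G u v \<le> graph_dist G v u" "graph_dist G v u \<le> graph_dist G u v"
    using assms by blast+
qed

lemma graph_dist_triangle:
  assumes "u \<in> verts G" "v \<in> verts G" "w \<in> verts G"
  shows "graph_dist G u w \<le> graph_dist G u v + graph_dist G v w"
proof -
  obtain p q where "awalk u p v" "length p = graph_dist G u v"
    "awalk v q w" "length q = graph_dist G v w"
    using assms ex_geodesic by meson
  then show ?thesis using graph_dist_le[OF awalk_appendI[of u p v q w]] by simp
qed

lemma graph_dist_eq_0_iff:
  assumes "u \<in> verts G" "v \<in> verts G"
  shows "graph_dist G u v = 0 \<longleftrightarrow> u = v"
proof
  assume "graph_dist G u v = 0"
  with ex_geodesic[OF assms] show "u = v" by (auto simp: awalk_Nil_iff)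
next
  assume "u = v"
  then show "graph_dist G u v = 0"
    using graph_dist_le[of u "[]" u] assms by (auto simp: awalk_Nil_iff)
qed

lemma graph_dist_eq_1_iff:
  assumes "u \<in> verts G" "v \<in> verts G"
  shows "graph_dist G u v = 1 \<longleftrightarrow> u \<rightarrow>\<^bsub>G\<^esub> v"
proof
  assume "graph_dist G u v = 1"
  with ex_geodesic[OF assms] obtain e where "awalk u [e] v"
    by (auto simp: length_Suc_conv)
  then show "u \<rightarrow>\<^bsub>G\<^esub> v" by (auto simp: awalk_simps intro: in_arcs_imp_in_arcs_ends)
next
  assume uv: "u \<rightarrow>\<^bsub>G\<^esub> v"
  then obtain e where "e \<in> arcs G" "tail G e = u" "head G e = v" by (rule reachableE)
  then have "graph_dist G u v \<le> 1"
    using graph_dist_le[of u "[e]" v] arc_implies_awalk by fastforce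
  moreover have "graph_dist G u v \<noteq> 0"
    using uv graph_dist_eq_0_iff[OF assms] adj_not_same[of v] by auto
  ultimately show "graph_dist G u v = 1" by simp
qed

lemma graph_dist_pred:
  assumes "u \<in> verts G" "v \<in> verts G" "graph_dist G u v = Suc i"
  shows "\<exists>w\<in>verts G. v \<rightarrow>\<^bsub>G\<^esub> w \<and> graph_dist G u w = i"
proof -
  obtain p where p: "awalk u p v" "length p = Suc i"
    using ex_geodesic[OF assms(1,2)] assms(3) by auto
  \<comment> \<open>The tail of the last arc of a geodesic is the required vertex: the initial part
    bounds its distance by \<open>i\<close>, and the triangle inequality excludes less.\<close>
  then obtain q e where pq: "p = q @ [e]" by (cases p rule: rev_cases) auto
  define w where "w = tail G e"
  have q: "awalk u q w" and e: "e \<in> arcs G" "head G e = v"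
    using p(1) unfolding pq w_def by (auto simp: awalk_simps)
  from e(1) have w: "w \<in> verts G" by (simp add: w_def)
  have wv: "w \<rightarrow>\<^bsub>G\<^esub> v" using e in_arcs_imp_in_arcs_ends[of e] by (simp add: w_def)
  then have "graph_dist G w v = 1" using graph_dist_eq_1_iff w assms(2) by blast
  moreover have "graph_dist G u w \<le> i" using graph_dist_le[OF q] p(2) pq by simp
  ultimately have "graph_dist G u w = i"
    using graph_dist_triangle[OF assms(1) w assms(2)] assms(3) by simp
  moreover have "v \<rightarrow>\<^bsub>G\<^esub> w" using arcs_ends_symmetric[OF sym_arcs wv] .
  ultimately show ?thesis using w by blast
qed

lemma drg_graph:
  assumes "intersection_numbers G bs cs"
  shows "drg (verts G) (\<lambda>x y. x \<rightarrow>\<^bsub>G\<^esub> y) (graph_dist G) (graph_diameter G) bs cs"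
proof -
  let ?d = "graph_dist G"
  let ?A = "{?d x y | x y. x \<in> verts G \<and> y \<in> verts G}"
  have "?A = (\<lambda>(x, y). ?d x y) ` (verts G \<times> verts G)" by auto
  then have finA: "finite ?A" by simp
  \<comment> \<open>Connectedness includes that there is a vertex, so the maximum defining the
    diameter is attained.\<close>
  obtain v where "v \<in> verts G"
    using symmetric_connected_imp_strongly_connected[OF sym_arcs conn]
    by (auto simp: strongly_connected_def)
  then have "?A \<noteq> {}" by blast
  then have "graph_diameter G \<in> ?A"
    unfolding graph_diameter_def using finA by (rule Max_in[rotated])
  then obtain x y where "x \<in> verts G" "y \<in> verts G" "?d x y = graph_diameter G" by auto
  then have attained: "\<exists>x\<in>verts G. \<exists>y\<in>verts G. ?d x y = graph_diameter G" by blast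
  have le: "?d x y \<le> graph_diameter G" if "x \<in> verts G" "y \<in> verts G" for x y
    unfolding graph_diameter_def using finA that by (intro Max_ge) auto
  show ?thesis
  proof (rule drg.intro, goal_cases)
    case 1
    then show ?case by simp
  next
    case (2 x y)
    then show ?case by (rule graph_dist_eq_0_iff)
  next
    case (3 x y)
    then show ?case by (rule graph_dist_sym)
  next
    case (4 x y z)
    then show ?case by (rule graph_dist_triangle)
  next
    case (5 x y)
    then show ?case by (rule graph_dist_eq_1_iff[symmetric])
  next
    case (6 x y i)
    then show ?case by (rule graph_dist_pred)
  next
    case (7 x y)
    then show ?case by (rule le)
  next
    case 8
    show ?case by (rule attained)
  next
    case (9 x y)
    with le assms show ?case by (simp add: intersection_numbers_def)
  next
    case (10 x y)
    with le assms show ?case by (simp add: intersection_numbers_def)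
  qed
qed

end

end

section \<open>Classical parameters with \<open>b = 2\<close>\<close>

context drg
begin

text \<open>
  On functions of the distance \<open>i\<close>, the graph Laplacian maps \<open>x = 1 / 2 ^ i\<close> to \<open>l * x + M\<close> and \<open>x\<^sup>2\<close>
  to a quadratic polynomial in \<open>x\<close>. So the eigenfunction \<open>u\<close> is affine in \<open>x\<close>, and the quadratic
  polynomial \<open>q\<close> and the number \<open>m\<close> are found by comparing coefficients.
\<close>

lemma multiplicity_alpha_9:
  fixes \<beta> :: real
  assumes c_eq: "\<And>i. i \<le> D \<Longrightarrow> c i = (2 ^ i - 1) * (1 + 9 * (2 ^ (i - 1) - 1 :: real))"
    and b_eq: "\<And>i. i \<le> D \<Longrightarrow> b i = (2 ^ D - 2 ^ i) * (\<beta> - 9 * (2 ^ i - 1 :: real))"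
    and D: "2 \<le> D" and \<beta>: "7 < \<beta>"
  obtains m :: nat where
    "m * ((9 * 2 ^ D / 2 - 8) * (\<beta> - 7)) = (2 ^ D - 1) * \<beta> * (2 ^ D * (\<beta> + 9) / 2 - 16)"
proof -
  define P :: real where "P = 2 ^ D"
  have P: "4 \<le> P" unfolding P_def using power_increasing[OF D, of "2 :: real"] by simp
  \<comment> \<open>\<open>l\<close> is the Laplacian eigenvalue, so the adjacency eigenvalue is
    \<open>b 0 + l\<close>. An eigenfunction is \<open>M + l * x\<close>, and
    \<open>\<kappa>\<close> is its value at \<open>x = 1\<close>, that is at distance 0, which
    normalises \<open>u 0\<close> to 1.\<close>
  define l where "l = 8 - P * (\<beta> + 9) / 2"
  define M where "M = (9 * P + \<beta> - 16) / 2"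
  define \<kappa> where "\<kappa> = l + M"
  have \<kappa>: "\<kappa> = - (P - 1) * \<beta> / 2" by (simp add: \<kappa>_def l_def M_def field_simps)
  have "16 < 4 * (\<beta> + 9) / 2" using \<beta> by simp
  also have "\<dots> \<le> P * (\<beta> + 9) / 2" using P \<beta> by (intro divide_right_mono mult_right_mono) auto
  finally have l8: "l + 8 < 0" by (simp add: l_def)
  define Q where "Q = 16 * M + 9 * l"
  have Q: "Q = - (9 * P / 2 - 8) * (\<beta> - 7)" by (simp add: Q_def l_def M_def field_simps)
  have nz: "\<kappa> \<noteq> 0" "l + 8 \<noteq> 0" "Q \<noteq> 0"
    using l8 P \<beta> unfolding \<kappa> Q by auto
  \<comment> \<open>The coefficients of \<open>x\<^sup>2\<close> and \<open>x\<close> in the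
    equation for \<open>q\<close> determine \<open>C\<close> and \<open>A\<close>, which requires
    \<open>l + 8 \<noteq> 0\<close>; the constant coefficient, checked in \<open>const\<close>, then
    fixes \<open>m\<close>.\<close>
  define m where "m = - 2 * \<kappa> * (l + 8) / Q"
  define r where "r = m / \<kappa>\<^sup>2"
  define N where "N = l + 8"
  define A where "A = r * (2 * l * M + 32 * M + 25 * l) / (2 * N)"
  define C where "C = 2 * r * l\<^sup>2 / (3 * N)"
  define u where "u i = (M + l * (1 / 2 ^ i)) / \<kappa>" for i :: nat
  define q where "q i = A * (1 / 2 ^ i) + C * (1 / 2 ^ i)\<^sup>2" for i :: nat
  have l: "l = N - 8" and N: "N \<noteq> 0" using nz(2) by (simp_all add: N_def)
  have mQ: "m * Q = - 2 * \<kappa> * (l + 8)" using nz by (simp add: m_def)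
  have C: "C * (3 / 2 * (l + 8)) = r * l\<^sup>2"
    using N by (simp add: C_def N_def[symmetric])
  have A: "A * l + C * (3 / 4 * (2 * M - 25)) = 2 * r * M * l"
    unfolding A_def C_def l using N by (simp add: field_simps power2_eq_square)
  have const: "A * M + C * (27 / 4) = r * M\<^sup>2 - 1"
  proof -
    have "A * M + C * (27 / 4) - r * M\<^sup>2 = r * Q * \<kappa> / (2 * N)"
      unfolding A_def C_def Q_def \<kappa>_def l using N by (simp add: field_simps power2_eq_square)
    also have "r * Q * \<kappa> = m * Q / \<kappa>"
      using nz(1) by (simp add: r_def power2_eq_square)
    also have "\<dots> = - 2 * N"
      unfolding mQ using nz(1) by (simp add: N_def)
    finally show ?thesis using N by simp
  qed
  \<comment> \<open>Passing to \<open>i - 1\<close> doubles \<open>x\<close> and passing to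
    \<open>i + 1\<close> halves it, whence the differences \<open>x\<close>, \<open>- x / 2\<close>
    and \<open>3 * x\<^sup>2\<close>, \<open>- 3 / 4 * x\<^sup>2\<close>.\<close>
  have L: "c i * x - b i * x / 2 = l * x + M"
    "c i * (3 * x\<^sup>2) - b i * (3 / 4 * x\<^sup>2) = 27 / 4 + 3 / 4 * (2 * M - 25) * x + 3 / 2 * (l + 8) * x\<^sup>2"
    if i: "i \<le> D" and x: "x = 1 / 2 ^ i" for i and x :: real
  proof -
    have X: "2 ^ i = 1 / x" "x \<noteq> 0" unfolding x by auto
    have ci: "c i = (1 / x - 1) * (9 / (2 * x) - 8)"
    \<comment> \<open>At \<open>i = 0\<close> the truncated exponent does not give
      \<open>1 / (2 * x)\<close>, but the factor \<open>1 / x - 1\<close> is zero there.\<close>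
    proof (cases i)
      case 0
      then show ?thesis using x c_0 by simp
    next
      case (Suc j)
      then have "2 ^ (i - 1) = (1 / x) / (2 :: real)" using X(1) by simp
      then show ?thesis using c_eq[OF i] X(1) by simp
    qed
    have bi: "b i = (P - 1 / x) * (\<beta> + 9 - 9 / x)"
      using b_eq[OF i] X(1) by (simp add: P_def algebra_simps)
    show "c i * x - b i * x / 2 = l * x + M"
      unfolding ci bi l_def M_def using X(2) by (simp add: field_simps power2_eq_square)
    show "c i * (3 * x\<^sup>2) - b i * (3 / 4 * x\<^sup>2) = 27 / 4 + 3 / 4 * (2 * M - 25) * x + 3 / 2 * (l + 8) * x\<^sup>2"
      unfolding ci bi l_def M_def using X(2) by (simp add: field_simps power2_eq_square)
  qed
  have "m \<in> \<nat>"
  proof (rule multiplicity_nat[of u "b 0 + l" q])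
    show "u 0 = 1" using nz by (simp add: u_def \<kappa>_def add.commute)
  next
    fix i assume i: "i \<le> D"
    define x :: real where "x = 1 / 2 ^ i"
    have u_i: "u i = (M + l * x) / \<kappa>" "u (i + 1) = (M + l * (x / 2)) / \<kappa>"
      by (simp_all add: u_def x_def)
    have "c i * u (i - 1) = c i * ((M + l * (2 * x)) / \<kappa>)"
      using c_0 by (cases i) (simp_all add: u_def x_def)
    then have "c i * u (i - 1) + a i * u i + b i * u (i + 1) =
      (b 0 * (M + l * x) + l * (c i * x - b i * x / 2)) / \<kappa>"
      unfolding u_i a_def by (simp add: add_divide_distrib[symmetric] diff_divide_distrib[symmetric] algebra_simps)
    also have "\<dots> = (b 0 + l) * u i"
      unfolding L(1)[OF i x_def] u_i by (simp add: algebra_simps)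
    finally show "c i * u (i - 1) + a i * u i + b i * u (i + 1) = (b 0 + l) * u i" .
    have q_i: "q i = A * x + C * x\<^sup>2" "q (i + 1) = A * (x / 2) + C * (x / 2)\<^sup>2"
      by (simp_all add: q_def x_def mult.commute)
    have "c i * (q (i - 1) - q i) = c i * (A * (2 * x) + C * (2 * x)\<^sup>2 - q i)"
      using c_0 by (cases i) (simp_all add: q_def x_def)
    then have "c i * (q (i - 1) - q i) + b i * (q (i + 1) - q i) =
      A * (c i * x - b i * x / 2) + C * (c i * (3 * x\<^sup>2) - b i * (3 / 4 * x\<^sup>2))"
      unfolding q_i by (simp add: power2_eq_square algebra_simps)
    also have "\<dots> = (A * M + C * (27 / 4)) + (A * l + C * (3 / 4 * (2 * M - 25))) * x +
      C * (3 / 2 * (l + 8)) * x\<^sup>2"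
      unfolding L[OF i x_def] by (simp add: algebra_simps)
    also have "\<dots> = m * (u i)\<^sup>2 - 1"
      unfolding A C const u_i r_def using nz(1) by (simp add: field_simps power2_eq_square)
    finally show "c i * (q (i - 1) - q i) + b i * (q (i + 1) - q i) = m * (u i)\<^sup>2 - 1" .
  qed
  then obtain n where n: "m = real n" by (rule Nats_cases)
  have "real n * ((9 * P / 2 - 8) * (\<beta> - 7)) = (P - 1) * \<beta> * (P * (\<beta> + 9) / 2 - 16)"
    using mQ unfolding n Q \<kappa> l_def by (simp add: field_simps)
  then show ?thesis using that unfolding P_def by blast
qed

lemma alpha_classical_2:
  fixes \<alpha> \<beta> :: real
  assumes c_eq: "\<And>i. i \<le> D \<Longrightarrow> c i = (2 ^ i - 1) * (1 + \<alpha> * (2 ^ (i - 1) - 1))"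
    and b_eq: "\<And>i. i \<le> D \<Longrightarrow> b i = (2 ^ D - 2 ^ i) * (\<beta> - \<alpha> * (2 ^ i - 1))"
    and D: "12 \<le> D"
  shows "\<alpha> \<in> {0, 1/3, 2/3, 1, 4/3, 2}"
proof -
  define t where "t = c 2 - 3"
  have \<alpha>: "\<alpha> = t / 3" using c_eq[of 2] D by (simp add: t_def)
  have c_scaled: "3 * c (Suc k) = scaled_c t k" if "Suc k \<le> D" for k
  proof -
    have "real_of_int (3 * c (Suc k)) = real_of_int (scaled_c t k)"
      using c_eq[OF that] by (simp add: \<alpha> scaled_c_def)
    then show ?thesis by (simp only: of_int_eq_iff)
  qed
  have scaled_prod: "(\<Prod>k<n. scaled_c t k) = 3 ^ n * (\<Prod>k<n. c (Suc k))" if "n \<le> D" for n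
    using that by (simp add: c_scaled[symmetric] prod.distrib)
  have scaled_dvd: "(\<Prod>k<n. scaled_c t k) * (\<Prod>k<n. scaled_c t k) dvd (\<Prod>k<n + n. scaled_c t k)"
    if "n + n \<le> D" for n
  proof -
    have "3 ^ (n + n) * ((\<Prod>k<n. c (Suc k)) * (\<Prod>k<n. c (Suc k))) dvd 3 ^ (n + n) * (\<Prod>k<n + n. c (Suc k))"
      by (rule mult_dvd_mono[OF dvd_refl prod_c_dvd[OF that]])
    then show ?thesis using that by (simp add: scaled_prod power_add ac_simps)
  qed
  \<comment> \<open>A negative integer \<open>t\<close> would make the factor
    \<open>3 + t * (2 ^ 11 - 1)\<close> of \<open>scaled_c t 11\<close> negative.\<close>
  have "0 < 3 * c (Suc 11)" using c_pos[of 12] D by simp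
  then have "0 < scaled_c t 11" using c_scaled[of 11] D by simp
  then have t: "0 \<le> t" by (simp add: scaled_c_def zero_less_mult_iff)
  have "t + 3 dvd 1260"
    by (rule scaled_c_4) (use scaled_dvd[of 2] D t in auto)
  then have "t + 3 \<in> {3, 4, 5, 6, 7, 9, 30}"
    by (intro scaled_c_12 dvd_1260) (use scaled_dvd[of 6] D t in auto)
  moreover have "t \<noteq> 27"
  proof
    assume t27: "t = 27"
    then have "\<not> 14 \<le> D" using scaled_dvd[of 7] scaled_c_14 by auto
    then have D_cases: "D = 12 \<or> D = 13" using D by linarith
    have \<alpha>9: "\<alpha> = 9" using \<alpha> t27 by simp
    \<comment> \<open>\<open>\<beta>\<close> is an integer, because
      \<open>a 1 + 1 = \<beta> + \<alpha> * (2 ^ D - 2)\<close>.\<close>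
    define B where "B = a 1 + 1 - 9 * (2 ^ D - 2)"
    have B: "\<beta> = B"
      using b_eq[of 0] b_eq[of 1] c_eq[of 1] D by (simp add: B_def a_def \<alpha>9 algebra_simps)
    \<comment> \<open>Positivity of the last nonzero \<open>b\<close> gives the lower bound on
      \<open>\<beta>\<close> that limits the divisor search.\<close>
    have "0 < real_of_int (b (D - 1))" using b_pos[of "D - 1"] D by simp
    then have "0 < (2 ^ D - 2 ^ (D - 1)) * (B - 9 * (2 ^ (D - 1) - 1 :: real))"
      using b_eq[of "D - 1"] D by (simp add: \<alpha>9 B)
    then have B_gr: "9 * (2 ^ (D - 1) - 1) < real_of_int B"
      by (auto simp: zero_less_mult_iff)
    have "(2 :: real) ^ 2 \<le> 2 ^ (D - 1)" using D by (intro power_increasing) auto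
    then have "7 < \<beta>" using B_gr unfolding B by simp
    obtain m :: nat where
      m: "m * ((9 * 2 ^ D / 2 - 8) * (\<beta> - 7)) = (2 ^ D - 1) * \<beta> * (2 ^ D * (\<beta> + 9) / 2 - 16)"
      by (rule multiplicity_alpha_9[of \<beta>])
        (use c_eq b_eq D \<open>7 < \<beta>\<close> in \<open>auto simp: \<alpha>9\<close>)
    from D_cases show False
    proof
      assume D12: "D = 12"
      \<comment> \<open>This is the identity for \<open>m\<close> at \<open>D = 12\<close> divided
        by 8; \<open>B - 7\<close> becomes the divisor in \<open>multiplicity_12\<close>.\<close>
      have "real_of_int (2303 * int m * (B - 7)) = real_of_int (8190 * (B * (128 * B + 1151)))"
        using m unfolding B D12 by (simp add: algebra_simps)
      then have "2303 * int m * (B - 7) = 8190 * (((B - 7) + 7) * (128 * (B - 7) + 2047))"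
        unfolding of_int_eq_iff by (simp add: algebra_simps)
      then have "B - 7 = 128961"
        by (rule multiplicity_12) (use B_gr D12 in simp)
      then have B': "B = 128968" by simp
      have "c (Suc j) = (2 ^ Suc j - 1) * (9 * 2 ^ j - 8)"
        and "b j = (4096 - 2 ^ j) * (128977 - 9 * 2 ^ j)" if "j < 7" for j
      proof -
        have "real_of_int (c (Suc j)) = real_of_int ((2 ^ Suc j - 1) * (9 * 2 ^ j - 8))"
          using c_eq[of "Suc j"] that D12 by (simp add: \<alpha>9 algebra_simps)
        then show "c (Suc j) = (2 ^ Suc j - 1) * (9 * 2 ^ j - 8)" by (simp only: of_int_eq_iff)
        have "real_of_int (b j) = real_of_int ((4096 - 2 ^ j) * (128977 - 9 * 2 ^ j))"
          using b_eq[of j] that D12 by (simp add: \<alpha>9 B B' algebra_simps)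
        then show "b j = (4096 - 2 ^ j) * (128977 - 9 * 2 ^ j)" by (simp only: of_int_eq_iff)
      qed
      moreover obtain x where "x \<in> V" using d_attained by blast
      with card_sphere[of x 7] D12
      have sphere: "(\<Prod>j<7. b j) = int (card {z \<in> V. d x z = 7}) * (\<Prod>j<7. c (Suc j))" by simp
      have "(\<Prod>j<7. c (Suc j)) dvd (\<Prod>j<7. b j)"
        unfolding sphere by (rule dvd_triv_right)
      ultimately show False using sphere_7 by simp
    next
      assume D13: "D = 13"
      have "real_of_int (4607 * int m * (B - 7)) = real_of_int (16382 * (B * (256 * B + 2303)))"
        using m unfolding B D13 by (simp add: algebra_simps)
      then have "4607 * int m * (B - 7) = 16382 * (((B - 7) + 7) * (256 * (B - 7) + 4095))"
        unfolding of_int_eq_iff by (simp add: algebra_simps)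
      then show False
        by (rule multiplicity_13) (use B_gr D13 in simp)
    qed
  qed
  ultimately have "t \<in> {0, 1, 2, 3, 4, 6}" by auto
  then show ?thesis using \<alpha> by auto
qed

end

lemma q_bracket_2: "q_bracket 2 i = 2 ^ i - 1"
  by (induction i) (simp_all add: q_bracket_def)

theorem theorem1p2:
  fixes G :: "('a, 'b) pre_digraph" and D :: nat and b \<alpha> \<beta> :: real
  assumes "distance_regular G"
    and "has_classical_parameters G D b \<alpha> \<beta>"
    and "b = 2"
    and "D \<ge> 12"
  shows "\<alpha> \<le> 2 \<and> \<alpha> \<in> {0, 1/3, 2/3, 1, 4/3, 2}"
proof -
  obtain bs cs where num: "intersection_numbers G bs cs" and diam: "graph_diameter G = D"
    and param: "\<And>i. i \<le> D \<Longrightarrow>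
      real_of_int (cs i) = q_bracket 2 i * (1 + \<alpha> * q_bracket 2 (i - 1)) \<and>
      real_of_int (bs i) = (q_bracket 2 D - q_bracket 2 i) * (\<beta> - \<alpha> * q_bracket 2 i)"
    using assms(2,3) unfolding has_classical_parameters_def by blast
  have "graph G" "connected G"
    using assms(1) by (simp_all add: distance_regular_def)
  then interpret drg "verts G" "\<lambda>x y. x \<rightarrow>\<^bsub>G\<^esub> y" "graph_dist G" D bs cs
    using graph.drg_graph[OF _ _ num] diam by simp
  have "\<alpha> \<in> {0, 1/3, 2/3, 1, 4/3, 2}"
    by (rule alpha_classical_2[of \<alpha> \<beta>]) (use param assms(4) in \<open>auto simp: q_bracket_2\<close>)
  then show ?thesis by auto
qed

end
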